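(* Let $\mathscr H$ be a complex Hilbert space, let $\mathfrak M$ be a nonempty set of bounded self-adjoint operators on $\mathscr H$ that is bounded from below, and let $M$ be a lower bound of $\mathfrak M$. (1) If $$\overline{\sum_{A\in\mathfrak M}\mathscr N(A-M)}=\mathscr H,\qquad( * )$$ then $M$ is a maximal lower bound of $\mathfrak M$. (2) If, additionally, $\mathfrak M$ is a finite set and the ranges of all operators $A-M$, $A\in\mathfrak M$, are closed, then condition $( * )$ is also necessary for the maximality of $M$.
   Context: $\mathfrak S$ denotes the real vector space of bounded self-adjoint operators on $\mathscr H$, with Löwner's order: $S\le T$ iff $(Su,u)\le (Tu,u)$ for all $u\in\mathscr H$. $\mathscr N(S)$ is the null space of $S$; the overline denotes closure in $\mathscr H$, and the sum is the linear span of the subspaces involved (finite sums of vectors). An operator $L\in\mathfrak S$ is a lower bound of $\mathfrak M$ if $L\le A$ for all $A\in\mathfrak M$; $\mathfrak M$ is bounded from below if it has a lower bound. A maximal lower bound is a maximal element $M$ of the set $\mathfrak L$ of all lower bounds: $L\in\mathfrak L$ and $M\le L$ imply $L=M$. *)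

theory Defs
  imports "HOL-Analysis.Analysis"
begin

class complex_vector = real_vector +
  fixes scaleC :: "complex \<Rightarrow> 'a \<Rightarrow> 'a"  (infixr \<open>*\<^sub>C\<close> 75)
  assumes scaleC_add_right: "a *\<^sub>C (x + y) = a *\<^sub>C x + a *\<^sub>C y"
    and scaleC_add_left: "(a + b) *\<^sub>C x = a *\<^sub>C x + b *\<^sub>C x"
    and scaleC_scaleC: "a *\<^sub>C (b *\<^sub>C x) = (a * b) *\<^sub>C x"
    and scaleC_one: "1 *\<^sub>C x = x"
    and scaleC_of_real: "complex_of_real r *\<^sub>C x = r *\<^sub>R x"

global_interpretation complex_vector: vector_space "scaleC :: complex \<Rightarrow> 'a \<Rightarrow> 'a::complex_vector"
  defines cspan = complex_vector.span
  by unfold_locales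
    (simp_all add: scaleC_add_right scaleC_add_left scaleC_scaleC scaleC_one)

text \<open>
  The complex inner product is linear in the first argument. The underlying real inner product
  space carries the real part of the complex inner product, so norm, topology and positive
  definiteness are those of \<^class>\<open>real_inner\<close>, with \<open>norm x = sqrt (Re (cinner x x))\<close>.
\<close>

class complex_inner = complex_vector + real_inner +
  fixes cinner :: "'a \<Rightarrow> 'a \<Rightarrow> complex"
  assumes cinner_commute: "cinner x y = cnj (cinner y x)"
    and cinner_add_left: "cinner (x + y) z = cinner x z + cinner y z"
    and cinner_scaleC_left: "cinner (a *\<^sub>C x) y = a * cinner x y"
    and inner_eq_Re_cinner: "inner x y = Re (cinner x y)"

class complex_hilbert = complex_inner + banach

instantiation complex :: complex_hilbert
begin

definition scaleC_complex :: "complex \<Rightarrow> complex \<Rightarrow> complex"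
  where "scaleC_complex a x = a * x"

definition cinner_complex :: "complex \<Rightarrow> complex \<Rightarrow> complex"
  where "cinner_complex x y = x * cnj y"

instance
  by standard
    (simp_all add: scaleC_complex_def cinner_complex_def algebra_simps scaleR_conv_of_real
      inner_complex_def)

end

text \<open>
  The type \<^typ>\<open>'a \<Rightarrow>\<^sub>L 'a\<close> consists of the bounded real-linear maps, so complex linearity
  is required separately.
\<close>

definition self_adjoint_operators :: "('a::complex_hilbert \<Rightarrow>\<^sub>L 'a) set"
  where "self_adjoint_operators =
    {T :: 'a \<Rightarrow>\<^sub>L 'a. (\<forall>a x. T (a *\<^sub>C x) = a *\<^sub>C T x) \<and> (\<forall>x y. cinner (T x) y = cinner x (T y))}"

text \<open>For self-adjoint operators the numbers \<open>cinner (S u) u\<close> are real, so taking real parts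
  loses nothing.\<close>

definition loewner_le :: "('a::complex_hilbert \<Rightarrow>\<^sub>L 'a) \<Rightarrow> ('a \<Rightarrow>\<^sub>L 'a) \<Rightarrow> bool"  (infix \<open>\<preceq>\<close> 50)
  where "S \<preceq> T \<longleftrightarrow> (\<forall>u. Re (cinner (S u) u) \<le> Re (cinner (T u) u))"

definition null_space :: "('a::complex_hilbert \<Rightarrow>\<^sub>L 'a) \<Rightarrow> 'a set"
  where "null_space T = {x. blinfun_apply T x = 0}"

definition lower_bounds :: "('a::complex_hilbert \<Rightarrow>\<^sub>L 'a) set \<Rightarrow> ('a \<Rightarrow>\<^sub>L 'a) set"
  where "lower_bounds \<MM> = {L \<in> self_adjoint_operators. \<forall>A\<in>\<MM>. L \<preceq> A}"

definition bounded_from_below :: "('a::complex_hilbert \<Rightarrow>\<^sub>L 'a) set \<Rightarrow> bool"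
  where "bounded_from_below \<MM> \<longleftrightarrow> lower_bounds \<MM> \<noteq> {}"

definition maximal_lower_bound :: "('a::complex_hilbert \<Rightarrow>\<^sub>L 'a) set \<Rightarrow> ('a \<Rightarrow>\<^sub>L 'a) \<Rightarrow> bool"
  where "maximal_lower_bound \<MM> M \<longleftrightarrow>
    M \<in> lower_bounds \<MM> \<and> (\<forall>L\<in>lower_bounds \<MM>. M \<preceq> L \<longrightarrow> L = M)"

end

theory Submission
  imports Defs
begin

text \<open>
  Both halves compare quadratic forms through the Cauchy--Schwarz inequality
  \<open>\<bar>(T u, v)\<bar>\<^sup>2 \<le> (T u, u) (T v, v)\<close> of a positive operator \<open>T\<close>.

  For sufficiency, let \<open>L\<close> be a lower bound above \<open>M\<close>. Then \<open>0 \<le> L - M \<le> A - M\<close> for every \<open>A\<close> of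
  the family, so the form of \<open>L - M\<close> vanishes on the null space of \<open>A - M\<close>; by Cauchy--Schwarz the
  operator \<open>L - M\<close> itself vanishes there. Being linear and continuous, it vanishes on the closed
  span of all these null spaces, which is the whole space.

  For necessity, suppose that the closed span is proper. The projection theorem gives a vector
  \<open>x \<noteq> 0\<close> orthogonal to the null space of each \<open>T = A - M\<close>. As \<open>T\<close> is self-adjoint with closed
  range, \<open>x = T y\<close> for some \<open>y\<close>, and Cauchy--Schwarz reads \<open>\<bar>(u, x)\<bar>\<^sup>2 \<le> (T y, y) (T u, u)\<close>: the
  rank-one operator \<open>u \<mapsto> (u, x) x\<close> lies below a multiple of \<open>T\<close>. For finitely many \<open>A\<close> one constant
  serves all of them, so a small positive multiple of this rank-one operator can be added to \<open>M\<close>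
  without leaving the set of lower bounds, and \<open>M\<close> is not maximal.
\<close>

section \<open>Orthogonal projection onto a closed subspace\<close>

text \<open>The discriminant inequality. It serves both for Cauchy--Schwarz and, with \<open>a = 0\<close>, to read off
  orthogonality from minimality of a distance.\<close>

lemma discriminant_le_of_quadratic_nonneg:
  fixes a b c :: real
  assumes nonneg: "\<And>t. 0 \<le> a - 2 * t * b + t\<^sup>2 * c"
    and "0 \<le> c"
  shows "b\<^sup>2 \<le> a * c"
proof (cases "c = 0")
  case True
  have "b = 0"
  proof (rule ccontr)
    assume "b \<noteq> 0"
    then show False
      using nonneg[of "(a + 1) / (2 * b)"] True by simp
  qed
  then show ?thesis using True by simp
next
  case False
  then have "0 < c" using \<open>0 \<le> c\<close> by simp
  have "0 \<le> (a - 2 * (b / c) * b + (b / c)\<^sup>2 * c) * c"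
    using nonneg[of "b / c"] \<open>0 \<le> c\<close> by (rule mult_nonneg_nonneg)
  also have "\<dots> = a * c - b\<^sup>2"
    using \<open>0 < c\<close> by (simp add: field_simps power2_eq_square)
  finally show ?thesis by simp
qed

lemma norm_diff_scaleR_squared:
  fixes x y :: "'a::real_inner"
  shows "(norm (x - t *\<^sub>R y))\<^sup>2 = (norm x)\<^sup>2 - 2 * t * inner x y + t\<^sup>2 * (norm y)\<^sup>2"
  unfolding power2_norm_eq_inner
  by (simp add: inner_diff_left inner_diff_right inner_commute power2_eq_square algebra_simps)

text \<open>A sequence in the subspace whose distances to \<open>x\<close> approach the infimum is Cauchy by the
  parallelogram law, as midpoints stay in the subspace; its limit is the foot of the perpendicular.\<close>

lemma orthogonal_projection_exists:
  fixes S :: "'a::{real_inner, banach} set"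
  assumes "subspace S" and "closed S"
  obtains p where "p \<in> S" and "\<And>s. s \<in> S \<Longrightarrow> inner (x - p) s = 0"
proof -
  define q where "q = (INF s\<in>S. (norm (x - s))\<^sup>2)"
  have bdd: "bdd_below ((\<lambda>s. (norm (x - s))\<^sup>2) ` S)"
    by (rule bdd_belowI[of _ 0]) auto
  have S_ne: "S \<noteq> {}" using subspace_0[OF \<open>subspace S\<close>] by auto
  have q_le: "q \<le> (norm (x - s))\<^sup>2" if "s \<in> S" for s
    unfolding q_def using bdd that by (rule cINF_lower)
  have "\<exists>s\<in>S. (norm (x - s))\<^sup>2 < q + inverse (real (Suc n))" for n
  proof -
    have "q < q + inverse (real (Suc n))" by simp
    then show ?thesis
      using cINF_less_iff[OF S_ne bdd] unfolding q_def by blast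
  qed
  then obtain s where s_S: "\<And>n. s n \<in> S"
    and s_near: "\<And>n. (norm (x - s n))\<^sup>2 < q + inverse (real (Suc n))"
    by metis
  have dist_s: "(dist (s m) (s n))\<^sup>2 \<le> 2 * inverse (real (Suc m)) + 2 * inverse (real (Suc n))"
    for m n
  proof -
    have mid: "(1/2) *\<^sub>R (s m + s n) \<in> S"
      using \<open>subspace S\<close> s_S by (simp add: subspace_add subspace_scale)
    have "(dist (s m) (s n))\<^sup>2 = 2 * (norm (x - s m))\<^sup>2 + 2 * (norm (x - s n))\<^sup>2
        - 4 * (norm (x - (1/2) *\<^sub>R (s m + s n)))\<^sup>2"
      unfolding dist_norm power2_norm_eq_inner
      by (simp add: inner_diff_left inner_diff_right inner_add_left inner_add_right
          inner_commute algebra_simps)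
    also have "\<dots> \<le> 2 * inverse (real (Suc m)) + 2 * inverse (real (Suc n))"
      using s_near[of m] s_near[of n] q_le[OF mid] by linarith
    finally show ?thesis .
  qed
  have "Cauchy s"
  proof (rule metric_CauchyI)
    fix e :: real assume "0 < e"
    then obtain N where N: "inverse (real (Suc N)) < e\<^sup>2 / 4"
      using reals_Archimedean[of "e\<^sup>2 / 4"] by auto
    have "dist (s m) (s n) < e" if "N \<le> m" "N \<le> n" for m n
    proof -
      have "inverse (real (Suc m)) \<le> inverse (real (Suc N))"
        "inverse (real (Suc n)) \<le> inverse (real (Suc N))"
        using that by (simp_all add: le_imp_inverse_le)
      then have "(dist (s m) (s n))\<^sup>2 < e\<^sup>2"
        using dist_s[of m n] N by linarith
      then show ?thesis
        using \<open>0 < e\<close> by (simp add: power_less_imp_less_base)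
    qed
    then show "\<exists>N. \<forall>m\<ge>N. \<forall>n\<ge>N. dist (s m) (s n) < e" by blast
  qed
  then obtain p where p: "s \<longlonglongrightarrow> p"
    using Cauchy_convergent_iff convergentD by blast
  have p_S: "p \<in> S"
    using \<open>closed S\<close> s_S p by (rule closed_sequentially)
  have lhs: "(\<lambda>n. (norm (x - s n))\<^sup>2) \<longlonglongrightarrow> (norm (x - p))\<^sup>2"
    by (intro tendsto_intros p)
  have rhs: "(\<lambda>n. q + inverse (real (Suc n))) \<longlonglongrightarrow> q + 0"
    by (intro tendsto_intros LIMSEQ_inverse_real_of_nat)
  have "(norm (x - p))\<^sup>2 \<le> q + 0"
    using lhs rhs by (rule LIMSEQ_le) (use s_near less_imp_le in blast)
  then have p_min: "(norm (x - p))\<^sup>2 \<le> q" by simp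
  have "inner (x - p) v = 0" if v: "v \<in> S" for v
  proof -
    have "0 \<le> 0 - 2 * t * inner (x - p) v + t\<^sup>2 * (norm v)\<^sup>2" for t
    proof -
      have "p + t *\<^sub>R v \<in> S"
        using \<open>subspace S\<close> p_S v by (simp add: subspace_add subspace_scale)
      then have "q \<le> (norm ((x - p) - t *\<^sub>R v))\<^sup>2"
        using q_le by (simp add: diff_diff_eq)
      then show ?thesis
        using p_min unfolding norm_diff_scaleR_squared by linarith
    qed
    then have "(inner (x - p) v)\<^sup>2 \<le> 0 * (norm v)\<^sup>2"
      by (rule discriminant_le_of_quadratic_nonneg) simp
    then show ?thesis by simp
  qed
  with p_S show ?thesis by (rule that)
qed

lemma subspace_closure:
  fixes S :: "'a::real_normed_vector set"
  assumes "subspace S"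
  shows "subspace (closure S)"
proof (rule subspaceI)
  show "0 \<in> closure S"
    using subspace_0[OF assms] closure_subset by blast
next
  fix x y assume "x \<in> closure S" "y \<in> closure S"
  then obtain f g where fg: "\<And>n. f n \<in> S" "f \<longlonglongrightarrow> x" "\<And>n. g n \<in> S" "g \<longlonglongrightarrow> y"
    unfolding closure_sequential by metis
  then have "(\<lambda>n. f n + g n) \<longlonglongrightarrow> x + y" "\<And>n. f n + g n \<in> S"
    using subspace_add[OF assms] by (auto intro: tendsto_add)
  then show "x + y \<in> closure S"
    unfolding closure_sequential by (intro exI[of _ "\<lambda>n. f n + g n"]) auto
next
  fix r :: real and x assume "x \<in> closure S"
  then obtain f where f: "\<And>n. f n \<in> S" "f \<longlonglongrightarrow> x"
    unfolding closure_sequential by metis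
  then have "(\<lambda>n. r *\<^sub>R f n) \<longlonglongrightarrow> r *\<^sub>R x" "\<And>n. r *\<^sub>R f n \<in> S"
    using subspace_scale[OF assms] by (auto intro: tendsto_scaleR)
  then show "r *\<^sub>R x \<in> closure S"
    unfolding closure_sequential by (intro exI[of _ "\<lambda>n. r *\<^sub>R f n"]) auto
qed

section \<open>The complex inner product\<close>

lemma cinner_add_right: "cinner x (y + z) = cinner x y + cinner x z"
  by (metis cinner_add_left cinner_commute complex_cnj_add)

lemma cinner_scaleC_right: "cinner x (a *\<^sub>C y) = cnj a * cinner x y"
  by (metis cinner_commute cinner_scaleC_left complex_cnj_mult)

lemma cinner_scaleR_left: "cinner (r *\<^sub>R x) y = complex_of_real r * cinner x y"
  by (metis cinner_scaleC_left scaleC_of_real)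

lemma cinner_scaleR_right: "cinner x (r *\<^sub>R y) = complex_of_real r * cinner x y"
  by (metis cinner_scaleC_right complex_cnj_complex_of_real scaleC_of_real)

lemma cinner_diff_left: "cinner (x - y) z = cinner x z - cinner y z"
  by (metis add_diff_cancel diff_add_cancel cinner_add_left)

lemma cinner_diff_right: "cinner x (y - z) = cinner x y - cinner x z"
  by (metis add_diff_cancel diff_add_cancel cinner_add_right)

lemma cinner_zero_left [simp]: "cinner 0 x = 0"
  using cinner_scaleR_left[of 0 0 x] by simp

lemma scaleC_scaleR_commute: "a *\<^sub>C (r *\<^sub>R x) = r *\<^sub>R (a *\<^sub>C x)"
  by (metis mult.commute scaleC_of_real scaleC_scaleC)

lemma scaleC_diff_right: "a *\<^sub>C (x - y) = a *\<^sub>C x - a *\<^sub>C (y :: 'a::complex_vector)"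
  by (metis add_diff_cancel diff_add_cancel scaleC_add_right)

lemma norm_scaleC: "norm (a *\<^sub>C x) = cmod a * norm (x :: 'a::complex_inner)"
proof -
  have "(norm (a *\<^sub>C x))\<^sup>2 = Re ((a * cnj a) * cinner x x)"
    by (simp add: power2_norm_eq_inner inner_eq_Re_cinner cinner_scaleC_left cinner_scaleC_right
        mult_ac)
  also have "\<dots> = (cmod a * norm x)\<^sup>2"
    by (simp add: complex_norm_square[symmetric] power_mult_distrib power2_norm_eq_inner
        inner_eq_Re_cinner del: of_real_power)
  finally show ?thesis
    by (simp add: power2_eq_iff_nonneg)
qed

lemma subspace_if_complex_subspace: "complex_vector.subspace S \<Longrightarrow> subspace S"
  by (metis complex_vector.subspace_def scaleC_of_real subspace_def)

section \<open>Self-adjoint and positive operators\<close>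

lemma self_adjointD:
  assumes "T \<in> self_adjoint_operators"
  shows "T (a *\<^sub>C x) = a *\<^sub>C T x" and "cinner (T x) y = cinner x (T y)"
  using assms by (auto simp: self_adjoint_operators_def)

lemma self_adjoint_add:
  "S \<in> self_adjoint_operators \<Longrightarrow> T \<in> self_adjoint_operators \<Longrightarrow> S + T \<in> self_adjoint_operators"
  by (auto simp: self_adjoint_operators_def plus_blinfun.rep_eq scaleC_add_right
      cinner_add_left cinner_add_right)

lemma self_adjoint_diff:
  "S \<in> self_adjoint_operators \<Longrightarrow> T \<in> self_adjoint_operators \<Longrightarrow> S - T \<in> self_adjoint_operators"
  by (auto simp: self_adjoint_operators_def minus_blinfun.rep_eq scaleC_diff_right
      cinner_diff_left cinner_diff_right)

lemma self_adjoint_scaleR: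
  "T \<in> self_adjoint_operators \<Longrightarrow> r *\<^sub>R T \<in> self_adjoint_operators"
  by (auto simp: self_adjoint_operators_def scaleR_blinfun.rep_eq scaleC_scaleR_commute
      cinner_scaleR_left cinner_scaleR_right)

lemma loewner_le_iff_diff: "S \<preceq> T \<longleftrightarrow> 0 \<preceq> T - S"
  by (simp add: loewner_le_def minus_blinfun.rep_eq cinner_diff_left)

lemma csubspace_null_space:
  assumes "T \<in> self_adjoint_operators"
  shows "complex_vector.subspace (null_space T)"
  using self_adjointD(1)[OF assms]
  by (auto simp: complex_vector.subspace_def null_space_def blinfun.add_right)

lemma closed_null_space: "closed (null_space T)"
  unfolding null_space_def
  by (intro closed_Collect_eq continuous_intros)

text \<open>The real part of \<open>(T u, v)\<close> is controlled by the discriminant of \<open>t \<mapsto> (T (u - t v), u - t v)\<close>;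
  multiplying \<open>u\<close> by a suitable unit scalar turns the real part into the modulus.\<close>

lemma positive_operator_Cauchy_Schwarz:
  assumes sa: "T \<in> self_adjoint_operators" and pos: "0 \<preceq> T"
  shows "(cmod (cinner (T u) v))\<^sup>2 \<le> Re (cinner (T u) u) * Re (cinner (T v) v)"
proof -
  have nonneg: "0 \<le> Re (cinner (T w) w)" for w
    using pos by (simp add: loewner_le_def)
  have real_part: "(Re (cinner (T w) v))\<^sup>2 \<le> Re (cinner (T w) w) * Re (cinner (T v) v)" for w
  proof (rule discriminant_le_of_quadratic_nonneg)
    fix t :: real
    have "Re (cinner (T v) w) = Re (cinner (T w) v)"
      by (metis sa self_adjointD(2) cinner_commute complex_cnj(1) complex.collapse complex.sel(1))
    then have "Re (cinner (T (w - t *\<^sub>R v)) (w - t *\<^sub>R v)) =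
        Re (cinner (T w) w) - 2 * t * Re (cinner (T w) v) + t\<^sup>2 * Re (cinner (T v) v)"
      by (simp add: blinfun.diff_right blinfun.scaleR_right cinner_diff_left cinner_diff_right
          cinner_scaleR_left cinner_scaleR_right power2_eq_square algebra_simps)
    then show "0 \<le> Re (cinner (T w) w) - 2 * t * Re (cinner (T w) v) + t\<^sup>2 * Re (cinner (T v) v)"
      using nonneg[of "w - t *\<^sub>R v"] by simp
  qed (rule nonneg)
  define z where "z = cinner (T u) v"
  obtain a where a: "cmod a = 1" "a * z = complex_of_real (cmod z)"
  proof (cases "z = 0")
    case True
    then show ?thesis using that[of 1] by simp
  next
    case False
    have "cnj (sgn z) * z = complex_of_real (cmod z)"
      using False by (simp add: sgn_eq complex_norm_square[symmetric] mult.commute[of "cnj z"]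
          power2_eq_square)
    then show ?thesis using that[of "cnj (sgn z)"] False by (simp add: norm_sgn)
  qed
  have "cinner (T (a *\<^sub>C u)) v = complex_of_real (cmod z)"
    using a(2) by (simp add: self_adjointD(1)[OF sa] cinner_scaleC_left z_def)
  moreover have "cinner (T (a *\<^sub>C u)) (a *\<^sub>C u) = cinner (T u) u"
  proof -
    have "cnj a * a = 1"
      using a(1) by (simp add: complex_norm_square[symmetric] mult.commute[of "cnj a"])
    then show ?thesis
      by (simp add: self_adjointD(1)[OF sa] cinner_scaleC_left cinner_scaleC_right
          mult.assoc[symmetric])
  qed
  ultimately show ?thesis
    using real_part[of "a *\<^sub>C u"] by (simp add: z_def)
qed

lemma positive_operator_zero_if_form_zero:
  assumes "T \<in> self_adjoint_operators" and "0 \<preceq> T" and "Re (cinner (T x) x) = 0"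
  shows "T x = 0"
proof -
  have "cinner (T x) (T x) = 0"
    using positive_operator_Cauchy_Schwarz[OF assms(1,2), of x "T x"] assms(3) by simp
  then show ?thesis
    by (metis inner_eq_Re_cinner inner_eq_zero_iff zero_complex.sel(1))
qed

text \<open>On a null vector of \<open>T\<close> the form of \<open>S\<close> is squeezed to zero, and a positive operator
  annihilates the zeros of its form.\<close>

lemma null_space_antimono:
  assumes "S \<in> self_adjoint_operators" and "0 \<preceq> S" and "S \<preceq> T"
  shows "null_space T \<subseteq> null_space S"
proof
  fix x assume "x \<in> null_space T"
  then have "Re (cinner (S x) x) \<le> 0"
    using \<open>S \<preceq> T\<close> by (metis (mono_tags) cinner_zero_left loewner_le_def mem_Collect_eq null_space_def
        zero_complex.sel(1))
  moreover have "0 \<le> Re (cinner (S x) x)"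
    using \<open>0 \<preceq> S\<close> by (simp add: loewner_le_def)
  ultimately show "x \<in> null_space S"
    using positive_operator_zero_if_form_zero[OF assms(1,2)] by (simp add: null_space_def)
qed

text \<open>The projection of \<open>x\<close> onto the range leaves a remainder orthogonal to the range, hence in the
  null space; as \<open>x\<close> is orthogonal to the null space, this remainder is zero.\<close>

lemma in_range_if_orthogonal_null_space:
  assumes sa: "T \<in> self_adjoint_operators" and cl: "closed (range (blinfun_apply T))"
    and orth: "\<And>v. v \<in> null_space T \<Longrightarrow> inner x v = 0"
  shows "x \<in> range (blinfun_apply T)"
proof -
  have "subspace (range (blinfun_apply T))"
    by (rule linear_subspace_image) (simp_all add: bounded_linear.linear[OF blinfun.bounded_linear_right])
  then obtain p where p: "p \<in> range (blinfun_apply T)"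
    and ort: "\<And>s. s \<in> range (blinfun_apply T) \<Longrightarrow> inner (x - p) s = 0"
    using orthogonal_projection_exists cl by metis
  have "inner (T (x - p)) w = 0" for w
    using ort[of "T w"] self_adjointD(2)[OF sa] by (simp add: inner_eq_Re_cinner)
  then have "T (x - p) = 0"
    using inner_eq_zero_iff by blast
  then have "inner x (x - p) = 0"
    by (intro orth) (simp add: null_space_def)
  moreover have "inner p (x - p) = 0"
    using ort[OF p] by (simp add: inner_commute)
  ultimately have "inner (x - p) (x - p) = 0"
    by (simp add: inner_diff_left)
  then show ?thesis using p by simp
qed

section \<open>Rank-one operators\<close>

lemma id_blinfun_self_adjoint_positive:
  "(id_blinfun :: 'a::complex_hilbert \<Rightarrow>\<^sub>L 'a) \<in> self_adjoint_operators"
  "0 \<preceq> (id_blinfun :: 'a::complex_hilbert \<Rightarrow>\<^sub>L 'a)"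
  by (simp_all add: self_adjoint_operators_def loewner_le_def inner_eq_Re_cinner[symmetric])

lemma cmod_cinner_le: "cmod (cinner u v) \<le> norm u * norm (v :: 'a::complex_hilbert)"
proof (rule power2_le_imp_le)
  show "(cmod (cinner u v))\<^sup>2 \<le> (norm u * norm v)\<^sup>2"
    using positive_operator_Cauchy_Schwarz[OF id_blinfun_self_adjoint_positive, of u v]
    by (simp add: power_mult_distrib power2_norm_eq_inner inner_eq_Re_cinner)
qed simp

definition rank_one :: "'a::complex_hilbert \<Rightarrow> 'a \<Rightarrow>\<^sub>L 'a"
  where "rank_one x = Blinfun (\<lambda>u. cinner u x *\<^sub>C x)"

lemma rank_one_apply: "rank_one x u = cinner u x *\<^sub>C x"
proof -
  have "bounded_linear (\<lambda>u. cinner u x *\<^sub>C x)"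
  proof (rule bounded_linear_intro[where K = "norm x * norm x"])
    show "norm (cinner u x *\<^sub>C x) \<le> norm u * (norm x * norm x)" for u
      using mult_right_mono[OF cmod_cinner_le[of u x], of "norm x"]
      by (simp add: norm_scaleC mult.assoc)
    show "cinner (u + v) x *\<^sub>C x = cinner u x *\<^sub>C x + cinner v x *\<^sub>C x" for u v
      by (simp add: cinner_add_left scaleC_add_left)
    show "cinner (r *\<^sub>R u) x *\<^sub>C x = r *\<^sub>R (cinner u x *\<^sub>C x)" for r u
      by (metis cinner_scaleR_left scaleC_of_real scaleC_scaleC)
  qed
  then show ?thesis
    unfolding rank_one_def by (simp add: bounded_linear_Blinfun_apply)
qed

lemma rank_one_self_adjoint: "rank_one x \<in> self_adjoint_operators"
proof -
  have "cinner (rank_one x u) v = cinner u (rank_one x v)" for u v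
    by (simp add: rank_one_apply cinner_scaleC_left cinner_scaleC_right cinner_commute[of x v])
  then show ?thesis
    by (simp add: self_adjoint_operators_def rank_one_apply cinner_scaleC_left scaleC_scaleC)
qed

lemma rank_one_form: "Re (cinner (rank_one x u) u) = (cmod (cinner u x))\<^sup>2"
proof -
  have "cinner (rank_one x u) u = cinner u x * cnj (cinner u x)"
    by (metis cinner_commute cinner_scaleC_left rank_one_apply)
  then show ?thesis
    by (metis Re_complex_of_real complex_norm_square)
qed

lemma rank_one_eq_zero_iff: "rank_one x = 0 \<longleftrightarrow> x = 0"
proof
  assume "rank_one x = 0"
  then have "cinner x x = 0"
    using rank_one_form[of x x] by simp
  then show "x = 0"
    by (metis inner_eq_Re_cinner inner_eq_zero_iff zero_complex.sel(1))
next
  assume "x = 0"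
  then show "rank_one x = 0"
    by (intro blinfun_eqI) (simp add: rank_one_apply)
qed

text \<open>With \<open>x = T y\<close>, this is the Cauchy--Schwarz inequality for \<open>(T u, y)\<close>, and the constant is
  \<open>(T y, y)\<close>.\<close>

lemma rank_one_le_multiple_if_closed_range:
  assumes sa: "T \<in> self_adjoint_operators" and pos: "0 \<preceq> T"
    and cl: "closed (range (blinfun_apply T))"
    and orth: "\<And>v. v \<in> null_space T \<Longrightarrow> inner x v = 0"
  shows "\<exists>c\<ge>0. rank_one x \<preceq> c *\<^sub>R T"
proof -
  obtain y where x: "x = T y"
    using in_range_if_orthogonal_null_space[OF sa cl orth] by auto
  have "rank_one x \<preceq> Re (cinner (T y) y) *\<^sub>R T"
    using positive_operator_Cauchy_Schwarz[OF sa pos, of _ y]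
    by (simp add: loewner_le_def rank_one_form x scaleR_blinfun.rep_eq cinner_scaleR_left
        self_adjointD(2)[OF sa, symmetric] mult.commute)
  moreover have "0 \<le> Re (cinner (T y) y)"
    using pos by (simp add: loewner_le_def)
  ultimately show ?thesis by blast
qed

section \<open>Maximal lower bounds\<close>

lemma maximal_lower_bound_if_null_spaces_dense:
  assumes M: "M \<in> lower_bounds \<MM>"
    and dense: "closure (cspan (\<Union>A\<in>\<MM>. null_space (A - M))) = UNIV"
  shows "maximal_lower_bound \<MM> M"
  unfolding maximal_lower_bound_def
proof (intro conjI ballI impI M)
  fix L assume L: "L \<in> lower_bounds \<MM>" and "M \<preceq> L"
  have sa: "L - M \<in> self_adjoint_operators"
    using L M by (auto simp: lower_bounds_def intro: self_adjoint_diff)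
  have "null_space (A - M) \<subseteq> null_space (L - M)" if "A \<in> \<MM>" for A
  proof (rule null_space_antimono[OF sa])
    show "0 \<preceq> L - M" using \<open>M \<preceq> L\<close> loewner_le_iff_diff by blast
    have "L \<preceq> A" using L that by (simp add: lower_bounds_def)
    then show "L - M \<preceq> A - M"
      by (simp add: loewner_le_def minus_blinfun.rep_eq cinner_diff_left)
  qed
  then have "cspan (\<Union>A\<in>\<MM>. null_space (A - M)) \<subseteq> null_space (L - M)"
    by (intro complex_vector.span_minimal csubspace_null_space[OF sa]) blast
  then have "closure (cspan (\<Union>A\<in>\<MM>. null_space (A - M))) \<subseteq> null_space (L - M)"
    using closed_null_space by (rule closure_minimal)
  then have "(L - M) u = 0" for u
    using dense by (auto simp: null_space_def)
  then show "L = M"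
    by (intro blinfun_eqI) (simp add: minus_blinfun.rep_eq)
qed

lemma null_spaces_dense_if_maximal_lower_bound:
  assumes sa_\<MM>: "\<MM> \<subseteq> self_adjoint_operators" and fin: "finite \<MM>"
    and cl: "\<And>A. A \<in> \<MM> \<Longrightarrow> closed (range (blinfun_apply (A - M)))"
    and maximal: "maximal_lower_bound \<MM> M"
  shows "closure (cspan (\<Union>A\<in>\<MM>. null_space (A - M))) = UNIV"
proof (rule ccontr)
  let ?V = "cspan (\<Union>A\<in>\<MM>. null_space (A - M))"
  assume "closure ?V \<noteq> UNIV"
  then obtain z where z: "z \<notin> closure ?V" by auto
  have "subspace (closure ?V)"
    by (intro subspace_closure subspace_if_complex_subspace complex_vector.subspace_span)
  then obtain p where p: "p \<in> closure ?V"
    and ort: "\<And>s. s \<in> closure ?V \<Longrightarrow> inner (z - p) s = 0"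
    using orthogonal_projection_exists by (metis closed_closure)
  define x where "x = z - p"
  have "x \<noteq> 0" using z p by (auto simp: x_def)
  have M: "M \<in> lower_bounds \<MM>"
    using maximal by (simp add: maximal_lower_bound_def)
  then have sa_M: "M \<in> self_adjoint_operators" and M_le: "\<And>A. A \<in> \<MM> \<Longrightarrow> M \<preceq> A"
    by (auto simp: lower_bounds_def)
  have "\<exists>c\<ge>0. rank_one x \<preceq> c *\<^sub>R (A - M)" if A: "A \<in> \<MM>" for A
  proof (rule rank_one_le_multiple_if_closed_range)
    show "A - M \<in> self_adjoint_operators"
      using A sa_\<MM> sa_M by (auto intro: self_adjoint_diff)
    show "0 \<preceq> A - M"
      using M_le[OF A] loewner_le_iff_diff by blast
    show "inner x v = 0" if "v \<in> null_space (A - M)" for v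
    proof -
      have "v \<in> ?V"
        using A that by (intro complex_vector.span_base) auto
      then show ?thesis
        using ort closure_subset unfolding x_def by blast
    qed
  qed (rule cl[OF A])
  then obtain c where c: "\<And>A. A \<in> \<MM> \<Longrightarrow> 0 \<le> c A"
    "\<And>A. A \<in> \<MM> \<Longrightarrow> rank_one x \<preceq> c A *\<^sub>R (A - M)"
    by metis
  \<comment> \<open>One constant for the whole family; the summand 1 makes it invertible.\<close>
  define K where "K = 1 + sum c \<MM>"
  have "0 < K" using c(1) by (simp add: K_def add_pos_nonneg sum_nonneg)
  define L where "L = M + inverse K *\<^sub>R rank_one x"
  have L_form: "Re (cinner (L u) u) =
      Re (cinner (M u) u) + inverse K * Re (cinner (rank_one x u) u)" for u
    by (simp add: L_def plus_blinfun.rep_eq scaleR_blinfun.rep_eq cinner_add_left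
        cinner_scaleR_left del: of_real_inverse)
  have "L \<preceq> A" if A: "A \<in> \<MM>" for A
    unfolding loewner_le_def
  proof
    fix u
    let ?b = "Re (cinner ((A - M) u) u)"
    have b: "0 \<le> ?b" "?b = Re (cinner (A u) u) - Re (cinner (M u) u)"
      using M_le[OF A] by (simp_all add: loewner_le_def minus_blinfun.rep_eq cinner_diff_left)
    have "c A \<le> K"
      using member_le_sum[OF A, of c] c(1) fin by (simp add: K_def)
    have "Re (cinner (rank_one x u) u) \<le> c A * ?b"
      using c(2)[OF A] by (simp add: loewner_le_def scaleR_blinfun.rep_eq cinner_scaleR_left)
    also have "\<dots> \<le> K * ?b"
      using \<open>c A \<le> K\<close> b(1) by (rule mult_right_mono)
    finally have "inverse K * Re (cinner (rank_one x u) u) \<le> ?b"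
      using \<open>0 < K\<close> by (simp add: inverse_eq_divide pos_divide_le_eq mult.commute)
    then show "Re (cinner (L u) u) \<le> Re (cinner (A u) u)"
      using b(2) by (simp add: L_form)
  qed
  moreover have "L \<in> self_adjoint_operators"
    unfolding L_def by (intro self_adjoint_add self_adjoint_scaleR rank_one_self_adjoint sa_M)
  ultimately have "L \<in> lower_bounds \<MM>"
    by (simp add: lower_bounds_def)
  moreover have "M \<preceq> L"
    using \<open>0 < K\<close> by (simp add: loewner_le_def L_form rank_one_form)
  ultimately have "L = M"
    using maximal by (simp add: maximal_lower_bound_def)
  then show False
    using \<open>0 < K\<close> \<open>x \<noteq> 0\<close> by (simp add: L_def rank_one_eq_zero_iff)
qed

theorem corollary4p4:
  fixes \<MM> :: "('a::complex_hilbert \<Rightarrow>\<^sub>L 'a) set" and M :: "'a \<Rightarrow>\<^sub>L 'a"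
  assumes "\<MM> \<subseteq> self_adjoint_operators"
    and "\<MM> \<noteq> {}"
    and "bounded_from_below \<MM>"
    and "M \<in> lower_bounds \<MM>"
  shows "(closure (cspan (\<Union>A\<in>\<MM>. null_space (A - M))) = UNIV \<longrightarrow> maximal_lower_bound \<MM> M) \<and>
    (finite \<MM> \<and> (\<forall>A\<in>\<MM>. closed (range (blinfun_apply (A - M)))) \<longrightarrow>
      maximal_lower_bound \<MM> M \<longrightarrow> closure (cspan (\<Union>A\<in>\<MM>. null_space (A - M))) = UNIV)"
  using assms maximal_lower_bound_if_null_spaces_dense null_spaces_dense_if_maximal_lower_bound
  by blast

end
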